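(* Let $A\in\mathbb{R}^{n\times n}$, $B\in\mathbb{R}^{n\times m}$, $C\in\mathbb{R}^{m\times n}$, $D\in\mathbb{R}^{m\times m}$, $F\in\mathbb{R}^{r\times n}$, $G\in\mathbb{R}^{r\times m}$, and consider the implicit Lur'e system $$x(t+1)=Ax(t)+Bu(t),\qquad 0\in Cx(t)+Du(t)+\Psi_t(Fx(t)+Gu(t)),$$ with set-valued mappings $\Psi_t:\mathbb{R}^r\to\mathcal{P}(\mathbb{R}^m)$, $t\in\mathbb{N}$. Suppose $D$ is invertible and $\Psi_t$ admits $M_1,\dots,M_p\in\mathbb{R}^{(r+m)\times(r+m)}$ as incremental multiplier matrices (IMMs), for every $t\in\mathbb{N}$. Let $\eta\in(0,1)$. If there exist a positive definite matrix $P\in\mathbb{R}^{n\times n}$ and nonnegative scalars $\lambda_1,\dots,\lambda_p$ such that $$\begin{bmatrix}A^\top PA-\eta^2P&A^\top PB\\ B^\top PA&B^\top PB\end{bmatrix}+\begin{bmatrix}F&G\\ -C&-D\end{bmatrix}^\top\Big(\sum_{i=1}^p\lambda_iM_i\Big)\begin{bmatrix}F&G\\ -C&-D\end{bmatrix}\prec0,$$ and such that, writing $$\begin{bmatrix}\bar M_{11}&\bar M_{12}\\ \bar M_{12}^\top&\bar M_{22}\end{bmatrix}:=\sum_{i=1}^p\lambda_iM_i,\qquad \bar M_{11}\in\mathbb{R}^{r\times r},\ \bar M_{12}\in\mathbb{R}^{r\times m},\ \bar M_{22}\in\mathbb{R}^{m\times m},$$ one has $\bar M_{22}\prec0$ and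 $\bar M_{12}=0$, then the generalized equation $0\in Cx+Du+\Psi_t(Fx+Gu)$ admits a unique solution $u\in\mathbb{R}^m$ for each $x\in\mathbb{R}^n$ and $t\in\mathbb{N}$.
   Context: $\mathcal{P}(S)$ is the power set of $S$. A set-valued mapping $\Psi:\mathbb{R}^{a}\to\mathcal{P}(\mathbb{R}^{b})$ admits the symmetric matrix $M\in\mathbb{R}^{(a+b)\times(a+b)}$ as an incremental multiplier matrix (IMM) if, for all $z^{(1)},z^{(2)}\in\mathbb{R}^a$ and all $g^{(1)}\in\Psi(z^{(1)})$, $g^{(2)}\in\Psi(z^{(2)})$, $$\begin{bmatrix}z^{(1)}-z^{(2)}\\ g^{(1)}-g^{(2)}\end{bmatrix}^\top M\begin{bmatrix}z^{(1)}-z^{(2)}\\ g^{(1)}-g^{(2)}\end{bmatrix}\ge0.$$ Positive/negative definite matrices are symmetric.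
   Formalization: The formal theorem additionally assumes that Ψ_t(z) is nonempty for every t and z; without this the claim is false, e.g. Ψ_t ≡ ∅ with n=m=r=p=1, A=B=C=F=G=0, D=1, P=1, η=1/2, λ_1=1, M_1=diag(0,−1) has no solution. *)

theory Defs
  imports "HOL-Analysis.Analysis" "HOL-Library.Set_Algebras"
begin

definition positive_definite :: "real ^ 'a ^ 'a \<Rightarrow> bool" where
  "positive_definite P \<longleftrightarrow> transpose P = P \<and> (\<forall>x. x \<noteq> 0 \<longrightarrow> x \<bullet> (P *v x) > 0)"

definition negative_definite :: "real ^ 'a ^ 'a \<Rightarrow> bool" where
  "negative_definite P \<longleftrightarrow> transpose P = P \<and> (\<forall>x. x \<noteq> 0 \<longrightarrow> x \<bullet> (P *v x) < 0)"

text \<open>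
  Stacked vectors and \<open>2 \<times> 2\<close> block matrices are indexed by the sum of the index types,
  \<^const>\<open>Inl\<close> being the first (upper, left) block and \<^const>\<open>Inr\<close> the second.
\<close>

definition stack :: "real ^ 'a \<Rightarrow> real ^ 'b \<Rightarrow> real ^ ('a + 'b)" where
  "stack z g = (\<chi> i. case i of Inl j \<Rightarrow> z $ j | Inr k \<Rightarrow> g $ k)"

definition block_mat ::
  "real ^ 'c ^ 'a \<Rightarrow> real ^ 'd ^ 'a \<Rightarrow> real ^ 'c ^ 'b \<Rightarrow> real ^ 'd ^ 'b
     \<Rightarrow> real ^ ('c + 'd) ^ ('a + 'b)" where
  "block_mat M11 M12 M21 M22 =
     (\<chi> i. case i of Inl j \<Rightarrow> stack (M11 $ j) (M12 $ j) | Inr k \<Rightarrow> stack (M21 $ k) (M22 $ k))"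

text \<open>\<open>IMM \<Psi> M\<close>: the set-valued map \<open>\<Psi>\<close> admits \<open>M\<close> as an incremental multiplier matrix.\<close>

definition IMM :: "(real ^ 'a \<Rightarrow> (real ^ 'b) set) \<Rightarrow> real ^ ('a + 'b) ^ ('a + 'b) \<Rightarrow> bool" where
  "IMM \<Psi> M \<longleftrightarrow> transpose M = M \<and>
     (\<forall>z1 z2. \<forall>g1 \<in> \<Psi> z1. \<forall>g2 \<in> \<Psi> z2.
        stack (z1 - z2) (g1 - g2) \<bullet> (M *v stack (z1 - z2) (g1 - g2)) \<ge> 0)"

end

theory Submission
  imports Defs
begin

text \<open>
  Write \<open>N = - M22\<close>, a positive definite matrix. Since \<open>M12 = 0\<close>, the weighted sum of the
  multiplier inequalities for \<open>\<Psi>\<close> decouples into \<open>dg \<bullet> N dg \<le> dz \<bullet> M11 dz\<close>. Taking \<open>dz = 0\<close>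
  shows that \<open>\<Psi>\<close> is single valued, so that the generalized equation is the fixed-point equation
  \<open>u = T u\<close> with \<open>T u = - D\<^sup>-\<^sup>1 (C x + \<Psi> (F x + G u))\<close>.

  The map \<open>T\<close> need not contract the Euclidean norm, but it contracts the norm whose square is the
  quadratic form \<open>Q v = D v \<bullet> N (D v)\<close> of the matrix \<open>K = D\<^sup>T N D\<close>: the factor \<open>D\<close> cancels the
  inverse in \<open>T\<close>, which leaves \<open>Q (T u - T v) \<le> G (u - v) \<bullet> M11 (G (u - v))\<close>. Testing the linear
  matrix inequality on stacked vectors \<open>(0, w)\<close> with \<open>w = u - v\<close>, and dropping the nonnegative
  term \<open>B w \<bullet> P (B w)\<close>, shows that the right-hand side is less than \<open>Q (u - v)\<close> unless \<open>u = v\<close>.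
  Compactness of the unit sphere upgrades this strict inequality to a uniform factor below 1
  (\<open>strict_quadratic_domination_uniform\<close>), and Banach's fixed-point theorem applies
  (\<open>quadratic_form_contraction_fixpoint\<close>).
\<close>

section \<open>Block matrices and quadratic forms\<close>

lemma inner_stack: "stack a b \<bullet> stack c d = a \<bullet> c + b \<bullet> d"
  unfolding inner_vec_def UNIV_Plus_UNIV[symmetric]
  by (subst sum.Plus) (simp_all add: stack_def)

lemma block_mat_mult_stack:
  "block_mat M11 M12 M21 M22 *v stack z g = stack (M11 *v z + M12 *v g) (M21 *v z + M22 *v g)"
proof -
  have row: "(block_mat M11 M12 M21 M22 *v stack z g) $ i
      = (block_mat M11 M12 M21 M22 $ i) \<bullet> stack z g" for i
    by (simp add: matrix_vector_mul_component)
  show ?thesis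
    unfolding vec_eq_iff row
    by (auto simp: block_mat_def inner_stack stack_def[of "_ *v _ + _"] matrix_vector_mul_component
      split: sum.split)
qed

lemma inner_congruence:
  fixes K :: "real ^ 'a ^ 'a" and H :: "real ^ 'b ^ 'a"
  shows "v \<bullet> ((transpose H ** K ** H) *v v) = (H *v v) \<bullet> (K *v (H *v v))"
proof -
  have "v \<bullet> (transpose H *v w) = (H *v v) \<bullet> w" for w
    using dot_lmul_matrix[of w H v] by (simp add: inner_commute)
  then show ?thesis by (simp only: flip: matrix_vector_mul_assoc)
qed

lemma matrix_vector_mult_uminus_left: "(- K) *v v = - (K *v v)"
  for K :: "real ^ 'b ^ 'a"
  using matrix_vector_mult_diff_rdistrib[of 0 K v] by simp

lemma IMM_nonneg_combination:
  fixes M :: "'i \<Rightarrow> real ^ ('a :: finite + 'b :: finite) ^ ('a + 'b)"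
  assumes "finite I" "\<And>i. i \<in> I \<Longrightarrow> IMM \<Psi> (M i)" "\<And>i. i \<in> I \<Longrightarrow> l i \<ge> 0"
    and "g1 \<in> \<Psi> z1" "g2 \<in> \<Psi> z2"
  shows "0 \<le> stack (z1 - z2) (g1 - g2) \<bullet> ((\<Sum>i\<in>I. l i *\<^sub>R M i) *v stack (z1 - z2) (g1 - g2))"
proof -
  have lin: "(\<Sum>i\<in>I. l i *\<^sub>R M i) *v w = (\<Sum>i\<in>I. l i *\<^sub>R (M i *v w))" for w
    using assms(1) by (induction I rule: finite_induct)
      (auto simp: matrix_vector_mult_add_rdistrib scaleR_matrix_vector_assoc)
  show ?thesis
    unfolding lin inner_sum_right using assms by (auto intro!: sum_nonneg simp: IMM_def)
qed

text \<open>The minimum of the form on the compact unit sphere is positive; homogeneity does the rest.\<close>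

lemma positive_quadratic_form_coercive:
  fixes K :: "real ^ 'a ^ 'a"
  assumes pos: "\<And>v. v \<noteq> 0 \<Longrightarrow> v \<bullet> (K *v v) > 0"
  obtains a where "a > 0" "\<And>v. a * (norm v)\<^sup>2 \<le> v \<bullet> (K *v v)"
proof -
  let ?S = "sphere (0 :: real ^ 'a) 1"
  have "compact ?S" "?S \<noteq> {}" by auto
  moreover have "continuous_on ?S (\<lambda>v. v \<bullet> (K *v v))"
    by (intro continuous_intros linear_continuous_on matrix_vector_mul_bounded_linear)
  ultimately obtain s where s: "s \<in> ?S" "\<And>v. v \<in> ?S \<Longrightarrow> s \<bullet> (K *v s) \<le> v \<bullet> (K *v v)"
    using continuous_attains_inf[of ?S "\<lambda>v. v \<bullet> (K *v v)"] by blast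
  have bound: "(s \<bullet> (K *v s)) * (norm v)\<^sup>2 \<le> v \<bullet> (K *v v)" for v
  proof (cases "v = 0")
    case False
    define w where "w = v /\<^sub>R norm v"
    have "w \<in> ?S" and v: "v = norm v *\<^sub>R w" using False by (auto simp: w_def)
    have "v \<bullet> (K *v v) = (norm v)\<^sup>2 * (w \<bullet> (K *v w))"
      by (subst (1 2) v) (simp add: matrix_vector_mult_scaleR power2_eq_square)
    moreover have "s \<bullet> (K *v s) \<le> w \<bullet> (K *v w)" using s(2) \<open>w \<in> ?S\<close> by blast
    ultimately show ?thesis by (metis mult.commute mult_right_mono zero_le_power2)
  qed simp
  have "s \<noteq> 0" using s(1) by auto
  show ?thesis by (rule that[OF pos[OF \<open>s \<noteq> 0\<close>] bound])
qed

lemma quadratic_form_bounded: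
  fixes K :: "real ^ 'a ^ 'a"
  obtains b where "b > 0" "\<And>v. v \<bullet> (K *v v) \<le> b * (norm v)\<^sup>2"
proof -
  obtain b where b: "b > 0" "\<And>v. norm (K *v v) \<le> norm v * b"
    using bounded_linear.pos_bounded[OF matrix_vector_mul_bounded_linear[of K]] by blast
  have "v \<bullet> (K *v v) \<le> b * (norm v)\<^sup>2" for v
  proof -
    have "v \<bullet> (K *v v) \<le> norm v * norm (K *v v)" by (rule norm_cauchy_schwarz)
    also have "\<dots> \<le> norm v * (norm v * b)" by (intro mult_left_mono b) simp
    finally show ?thesis by (simp add: power2_eq_square mult_ac)
  qed
  with b(1) show ?thesis by (rule that)
qed

text \<open>
  With \<open>c |v|\<^sup>2 \<le> (K - R) v\<close> and \<open>K v \<le> b |v|\<^sup>2\<close> as forms, subtracting gives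
  \<open>R \<le> (1 - c / b) K\<close>; enlarging \<open>b\<close> to \<open>b + c\<close> keeps the factor nonnegative.
\<close>

lemma strict_quadratic_domination_uniform:
  fixes K R :: "real ^ 'a ^ 'a"
  assumes less: "\<And>v. v \<noteq> 0 \<Longrightarrow> v \<bullet> (R *v v) < v \<bullet> (K *v v)"
  obtains q where "0 \<le> q" "q < 1" "\<And>v. v \<bullet> (R *v v) \<le> q * (v \<bullet> (K *v v))"
proof -
  obtain c where c: "c > 0" "\<And>v. c * (norm v)\<^sup>2 \<le> v \<bullet> ((K - R) *v v)"
    using positive_quadratic_form_coercive[of "K - R"] less
    by (auto simp: matrix_vector_mult_diff_rdistrib inner_diff_right)
  obtain b where b: "b > 0" "\<And>v. v \<bullet> (K *v v) \<le> b * (norm v)\<^sup>2"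
    using quadratic_form_bounded[of K] by blast
  define \<epsilon> where "\<epsilon> = c / (b + c)"
  have \<epsilon>: "0 < \<epsilon>" "\<epsilon> \<le> 1" using b(1) c(1) by (auto simp: \<epsilon>_def)
  have "v \<bullet> (R *v v) \<le> (1 - \<epsilon>) * (v \<bullet> (K *v v))" for v
  proof -
    have "v \<bullet> (K *v v) \<le> (b + c) * (norm v)\<^sup>2"
      using b(2)[of v] c(1) by (smt (verit) mult_right_mono zero_le_power2)
    then have "\<epsilon> * (v \<bullet> (K *v v)) \<le> \<epsilon> * ((b + c) * (norm v)\<^sup>2)"
      using \<epsilon>(1) by (intro mult_left_mono) auto
    also have "\<dots> = c * (norm v)\<^sup>2" using b(1) c(1) by (simp add: \<epsilon>_def)
    also have "\<dots> \<le> v \<bullet> (K *v v) - v \<bullet> (R *v v)"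
      using c(2)[of v] by (simp add: matrix_vector_mult_diff_rdistrib inner_diff_right)
    finally show ?thesis by (simp add: algebra_simps)
  qed
  then show ?thesis using \<epsilon> by (intro that[of "1 - \<epsilon>"]) auto
qed

section \<open>Contractions with respect to a quadratic form\<close>

text \<open>
  The form is equivalent to the squared Euclidean norm, so the constants of equivalence are
  absorbed by passing to a high iterate of \<open>T\<close>, which is a Euclidean contraction. The fixed point
  of the iterate is a fixed point of \<open>T\<close>, because \<open>T\<close> maps fixed points of the iterate to such.
\<close>

lemma quadratic_form_contraction_fixpoint:
  fixes K :: "real ^ 'a ^ 'a" and T :: "real ^ 'a \<Rightarrow> real ^ 'a"
  assumes pos: "\<And>v. v \<noteq> 0 \<Longrightarrow> v \<bullet> (K *v v) > 0"
    and q: "0 \<le> q" "q < 1"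
    and contr: "\<And>u v. (T u - T v) \<bullet> (K *v (T u - T v)) \<le> q * ((u - v) \<bullet> (K *v (u - v)))"
  shows "\<exists>!u. T u = u"
proof -
  define Q where "Q v = v \<bullet> (K *v v)" for v
  have contr': "Q (T u - T v) \<le> q * Q (u - v)" for u v
    using contr by (simp add: Q_def)
  obtain a where a: "a > 0" "\<And>v. a * (norm v)\<^sup>2 \<le> Q v"
    using positive_quadratic_form_coercive[OF pos] unfolding Q_def by blast
  obtain b where b: "b > 0" "\<And>v. Q v \<le> b * (norm v)\<^sup>2"
    using quadratic_form_bounded unfolding Q_def by blast
  have iter: "Q ((T ^^ k) u - (T ^^ k) v) \<le> q ^ k * Q (u - v)" for k u v
  proof (induction k)
    case (Suc k)
    have "Q ((T ^^ Suc k) u - (T ^^ Suc k) v) \<le> q * Q ((T ^^ k) u - (T ^^ k) v)"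
      using contr' by simp
    also have "\<dots> \<le> q * (q ^ k * Q (u - v))" using Suc q(1) by (rule mult_left_mono)
    finally show ?case by (simp add: mult.assoc)
  qed simp
  (* The factor 1/4 makes the k-th iterate at least halve Euclidean distances. *)
  obtain k where k: "q ^ k < a / (4 * b)"
    using real_arch_pow_inv[of "a / (4 * b)" q] a(1) b(1) q by auto
  have "dist ((T ^^ k) u) ((T ^^ k) v) \<le> 1 / 2 * dist u v" for u v
  proof -
    have "a * (norm ((T ^^ k) u - (T ^^ k) v))\<^sup>2 \<le> q ^ k * Q (u - v)"
      using a(2) iter order_trans by blast
    also have "\<dots> \<le> q ^ k * (b * (norm (u - v))\<^sup>2)"
      using b(2) q(1) by (intro mult_left_mono) auto
    also have "\<dots> \<le> a / (4 * b) * (b * (norm (u - v))\<^sup>2)"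
      using k b(1) by (intro mult_right_mono) auto
    also have "\<dots> = a * (1 / 2 * norm (u - v))\<^sup>2"
      using b(1) by (simp add: power2_eq_square)
    finally have "(norm ((T ^^ k) u - (T ^^ k) v))\<^sup>2 \<le> (1 / 2 * norm (u - v))\<^sup>2"
      using a(1) by simp
    then show ?thesis unfolding dist_norm by (rule power2_le_imp_le) simp
  qed
  then have ex1: "\<exists>!u. (T ^^ k) u = u"
    by (intro banach_fix_type[where c = "1 / 2"]) auto
  then obtain u where u: "(T ^^ k) u = u" by auto
  have "(T ^^ k) (T u) = T u" using u by (metis funpow_swap1)
  with u ex1 have "T u = u" by auto
  (* A fixed point of T is one of the iterate, hence uniqueness is inherited as well. *)
  moreover have "v = u" if "T v = v" for v
  proof -
    have "(T ^^ k) v = v" using that by (induction k) auto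
    with u ex1 show ?thesis by auto
  qed
  ultimately show ?thesis by blast
qed

section \<open>Well-posedness of the generalized equation\<close>

theorem proposition3:
  fixes A :: "real ^ 'n ^ 'n" and B :: "real ^ 'm ^ 'n"
    and C :: "real ^ 'n ^ 'm" and D :: "real ^ 'm ^ 'm"
    and F :: "real ^ 'n ^ 'r" and G :: "real ^ 'm ^ 'r"
    and \<Psi> :: "nat \<Rightarrow> real ^ 'r \<Rightarrow> (real ^ 'm) set"
    and p :: nat and M :: "nat \<Rightarrow> real ^ ('r + 'm) ^ ('r + 'm)"
    and \<eta> :: real
    and P :: "real ^ 'n ^ 'n" and l :: "nat \<Rightarrow> real"
    and M11 :: "real ^ 'r ^ 'r" and M12 :: "real ^ 'm ^ 'r" and M22 :: "real ^ 'm ^ 'm"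
  assumes nonempty: "\<And>t z. \<Psi> t z \<noteq> {}"
    and D: "invertible D"
    and IMM: "\<And>t i. i \<in> {1..p} \<Longrightarrow> IMM (\<Psi> t) (M i)"
    and \<eta>: "0 < \<eta>" "\<eta> < 1"
    and P: "positive_definite P"
    and l: "\<And>i. i \<in> {1..p} \<Longrightarrow> l i \<ge> 0"
    and LMI: "negative_definite
      (block_mat (transpose A ** P ** A - \<eta>\<^sup>2 *\<^sub>R P) (transpose A ** P ** B)
                 (transpose B ** P ** A) (transpose B ** P ** B)
       + transpose (block_mat F G (- C) (- D))
           ** (\<Sum>i=1..p. l i *\<^sub>R M i) ** block_mat F G (- C) (- D))"
    and blocks: "(\<Sum>i=1..p. l i *\<^sub>R M i) = block_mat M11 M12 (transpose M12) M22"
    and M22: "negative_definite M22"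
    and M12: "M12 = 0"
  shows "\<forall>x t. \<exists>!u. 0 \<in> (C *v x + D *v u) +o \<Psi> t (F *v x + G *v u)"
proof (intro allI)
  fix x t
  define N where "N = - M22"
  have N: "g \<bullet> (N *v g) = - (g \<bullet> (M22 *v g))" for g
    by (simp add: N_def matrix_vector_mult_uminus_left)
  have N_pos: "g \<bullet> (N *v g) > 0" if "g \<noteq> 0" for g
    using M22 that by (simp add: N negative_definite_def)
  have incr: "(g1 - g2) \<bullet> (N *v (g1 - g2)) \<le> (z1 - z2) \<bullet> (M11 *v (z1 - z2))"
    if "g1 \<in> \<Psi> t z1" "g2 \<in> \<Psi> t z2" for z1 z2 g1 g2
    using IMM_nonneg_combination[of "{1..p}" "\<Psi> t" M l g1 z1 g2 z2] IMM l that
    unfolding blocks M12 N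
    by (simp add: block_mat_mult_stack inner_stack transpose_def zero_vec_def[symmetric])
  have single: "g1 = g2" if "g1 \<in> \<Psi> t z" "g2 \<in> \<Psi> t z" for z g1 g2
    using incr[OF that] N_pos[of "g1 - g2"] by force
  define \<psi> where "\<psi> z = (SOME g. g \<in> \<Psi> t z)" for z
  have \<psi>: "g \<in> \<Psi> t z \<longleftrightarrow> g = \<psi> z" for g z
    using single nonempty[of t z] unfolding \<psi>_def by (metis ex_in_conv someI_ex)
  obtain D' where D': "D ** D' = mat 1" "D' ** D = mat 1"
    using D unfolding invertible_def by blast
  have D_inv: "D *v (D' *v g) = g" and inv_D: "D' *v (D *v g) = g" for g
    by (simp_all add: matrix_vector_mul_assoc D')
  define K where "K = transpose D ** N ** D"
  define R where "R = transpose G ** M11 ** G"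
  have K: "v \<bullet> (K *v v) = (D *v v) \<bullet> (N *v (D *v v))" for v
    unfolding K_def by (rule inner_congruence)
  have R: "v \<bullet> (R *v v) = (G *v v) \<bullet> (M11 *v (G *v v))" for v
    unfolding R_def by (rule inner_congruence)
  have K_pos: "v \<bullet> (K *v v) > 0" if "v \<noteq> 0" for v
    unfolding K using N_pos inv_D that by (metis matrix_vector_mult_0_right)
  (* The matrix inequality, tested on stacked vectors with vanishing state component. *)
  have "v \<bullet> (R *v v) < v \<bullet> (K *v v)" if "v \<noteq> 0" for v
  proof -
    let ?s = "stack 0 v :: real ^ ('n + 'm)"
    have "?s \<noteq> 0"
      using that by (metis inner_eq_zero_iff inner_stack inner_zero_left add_0)
    note neg = LMI[unfolded negative_definite_def, THEN conjunct2, rule_format, OF this]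
    have "v \<bullet> ((transpose B ** P ** B) *v v) + v \<bullet> (R *v v) - v \<bullet> (K *v v) < 0"
      using neg[unfolded matrix_vector_mult_add_rdistrib inner_add_right inner_congruence blocks M12]
      by (simp add: block_mat_mult_stack inner_stack K R N matrix_vector_mult_uminus_left
          linear_neg[OF matrix_vector_mul_linear])
    moreover have "v \<bullet> ((transpose B ** P ** B) *v v) \<ge> 0"
      unfolding inner_congruence using P
      by (cases "B *v v = 0") (auto simp: positive_definite_def less_imp_le)
    ultimately show ?thesis by linarith
  qed
  then obtain q where q: "0 \<le> q" "q < 1" "\<And>v. v \<bullet> (R *v v) \<le> q * (v \<bullet> (K *v v))"
    using strict_quadratic_domination_uniform by blast
  define T where "T u = - (D' *v (C *v x + \<psi> (F *v x + G *v u)))" for u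
  have "(T u - T v) \<bullet> (K *v (T u - T v)) \<le> q * ((u - v) \<bullet> (K *v (u - v)))" for u v
  proof -
    let ?g = "\<lambda>u. \<psi> (F *v x + G *v u)"
    have "T u - T v = D' *v (?g v - ?g u)"
      by (simp add: T_def algebra_simps)
    then have "(T u - T v) \<bullet> (K *v (T u - T v)) = (?g v - ?g u) \<bullet> (N *v (?g v - ?g u))"
      by (simp only: K D_inv)
    also have "\<dots> \<le> (v - u) \<bullet> (R *v (v - u))"
      using incr[of "?g v" "F *v x + G *v v" "?g u" "F *v x + G *v u"]
      by (simp add: \<psi> R[of "v - u"] matrix_vector_mult_diff_distrib[of G])
    also have "\<dots> = (u - v) \<bullet> (R *v (u - v))"
      by (simp add: algebra_simps)
    finally show ?thesis using q(3) order_trans by blast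
  qed
  from quadratic_form_contraction_fixpoint[OF K_pos q(1,2) this] have "\<exists>!u. T u = u" .
  moreover have "0 \<in> (C *v x + D *v u) +o \<Psi> t (F *v x + G *v u) \<longleftrightarrow> T u = u" for u
  proof -
    let ?g = "\<psi> (F *v x + G *v u)"
    have "0 \<in> (C *v x + D *v u) +o \<Psi> t (F *v x + G *v u) \<longleftrightarrow> C *v x + D *v u + ?g = 0"
      unfolding elt_set_plus_def Bex_def \<psi> by auto
    also have "\<dots> \<longleftrightarrow> D *v u = - (C *v x + ?g)"
      unfolding eq_neg_iff_add_eq_0 by (simp only: ac_simps)
    also have "\<dots> \<longleftrightarrow> D' *v (- (C *v x + ?g)) = u"
      using D_inv[of "- (C *v x + ?g)"] inv_D[of u] by auto
    also have "\<dots> \<longleftrightarrow> T u = u"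
      by (simp only: T_def linear_neg[OF matrix_vector_mul_linear])
    finally show ?thesis .
  qed
  ultimately show "\<exists>!u. 0 \<in> (C *v x + D *v u) +o \<Psi> t (F *v x + G *v u)" by (simp only:)
qed

end
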